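(* Let $\{X_n\}_{n\geq 1}$ be an orthogonal sequence of random variables in a sublinear expectation space $(\Omega,\mathcal{H},\widehat{\mathbb{E}})$, i.e. $\widehat{\mathbb{E}}[X_iX_j]=0$ for all $i\ne j$, satisfying $\widehat{\mathbb{E}}[X_n]=0$ for all $n\ge1$. Set $\sigma_n^2:=\widehat{\mathbb{E}}[X_n^2]$ and $S_n:=\sum_{k=1}^n X_k$. If $$\sum_{k=1}^{\infty}\frac{\sigma_k^2}{k^2}(\log_2 k)^2<\infty,$$ then $$\hat{\mathbb{V}}^*\left(\lim_{n\rightarrow\infty}\frac{S_n}{n}=0\right)=1.$$
   Context: Setting. $(\Omega,\mathcal{F})$ is a measurable space and $\mathcal{H}$ is a linear space of real-valued ($\mathcal{F}$-measurable) functions on $\Omega$ such that $X_1,\dots,X_n\in\mathcal{H}$ implies $\varphi(X_1,\dots,X_n)\in\mathcal{H}$ for every $\varphi\in C_{l,Lip}(\mathbb{R}^n)$. Here $C_{l,Lip}(\mathbb{R}^n)$ is the space of functions $\varphi$ with $|\varphi(x)-\varphi(y)|\le C(1+|x|^q+|y|^q)|x-y|$ for all $x,y\in\mathbb{R}^n$, for some $C>0$, $q\in\mathbb{N}$ depending on $\varphi$. Elements of $\mathcal{H}$ are called random variables. A sublinear expectation is a functional $\widehat{\mathbb{E}}:\mathcal{H}\to\mathbb{R}$ satisfying: (i) $\widehat{\mathbb{E}}[X]\le\widehat{\mathbb{E}}[Y]$ if $X\le Y$; (ii) $\widehat{\mathbb{E}}[c]=c$ for $c\in\mathbb{R}$;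 (iii) $\widehat{\mathbb{E}}[X+Y]\le\widehat{\mathbb{E}}[X]+\widehat{\mathbb{E}}[Y]$; (iv) $\widehat{\mathbb{E}}[\lambda X]=\lambda\widehat{\mathbb{E}}[X]$ for $\lambda\ge 0$. The triple $(\Omega,\mathcal{H},\widehat{\mathbb{E}})$ is a sublinear expectation space. Capacities. For $A\in\mathcal{F}$, $\hat{\mathbb{V}}(A):=\inf\{\widehat{\mathbb{E}}[\xi]: I_A\le\xi,\ \xi\in\mathcal{H}\}$ and $\hat{\mathbb{V}}^*(A):=\inf\{\sum_{n=1}^\infty\hat{\mathbb{V}}(A_n): A\subset\bigcup_{n=1}^\infty A_n,\ A_n\in\mathcal{F}\}$.
   Formalization: The formal theorem adds the assumption that V^*(Ω) = 1; without it the claim fails (Ω = ℕ, H the convergent sequences, E = lim, X_n = 0 gives V^*(Ω) = 0), and the stated conclusion itself forces V^*(Ω) = 1. *)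

theory Defs
  imports "HOL-Analysis.Analysis"
begin

(* The class C_{l,Lip}(R^n).  Since n is quantified inside the definition of a sublinear
   expectation space, a point of R^n is a sequence of which only the coordinates i < n
   count, and L2_set x {..<n} is its Euclidean norm.  The estimate forces phi to depend
   on these n coordinates only. *)
definition C_l_Lip :: "nat \<Rightarrow> ((nat \<Rightarrow> real) \<Rightarrow> real) set" where
  "C_l_Lip n = {\<phi>. \<exists>C>0. \<exists>q::nat. \<forall>x y.
     \<bar>\<phi> x - \<phi> y\<bar> \<le> C * (1 + L2_set x {..<n} ^ q + L2_set y {..<n} ^ q)
                      * L2_set (\<lambda>i. x i - y i) {..<n}}"

(* M only supplies the measurable space (space M, sets M); its measure plays no role.
   By monotonicity, EE X depends only on the values of X on space M. *)
locale sublinear_expectation_space =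
  fixes M :: "'a measure"
    and H :: "('a \<Rightarrow> real) set"
    and EE :: "('a \<Rightarrow> real) \<Rightarrow> real"
  assumes measurable: "H \<subseteq> borel_measurable M"
    and zero_mem: "(\<lambda>_. 0) \<in> H"
    and add_mem: "\<And>X Y. X \<in> H \<Longrightarrow> Y \<in> H \<Longrightarrow> (\<lambda>\<omega>. X \<omega> + Y \<omega>) \<in> H"
    and scale_mem: "\<And>X c. X \<in> H \<Longrightarrow> (\<lambda>\<omega>. c * X \<omega>) \<in> H"
    and C_l_Lip_mem: "\<And>n \<phi> X. 1 \<le> n \<Longrightarrow> \<phi> \<in> C_l_Lip n \<Longrightarrow> (\<And>i. i < n \<Longrightarrow> X i \<in> H)
                        \<Longrightarrow> (\<lambda>\<omega>. \<phi> (\<lambda>i. X i \<omega>)) \<in> H"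
    and mono: "\<And>X Y. X \<in> H \<Longrightarrow> Y \<in> H \<Longrightarrow> (\<And>\<omega>. \<omega> \<in> space M \<Longrightarrow> X \<omega> \<le> Y \<omega>) \<Longrightarrow> EE X \<le> EE Y"
    and const: "\<And>c. EE (\<lambda>_. c) = c"
    and subadd: "\<And>X Y. X \<in> H \<Longrightarrow> Y \<in> H \<Longrightarrow> EE (\<lambda>\<omega>. X \<omega> + Y \<omega>) \<le> EE X + EE Y"
    and pos_homogeneous: "\<And>X c. X \<in> H \<Longrightarrow> 0 \<le> c \<Longrightarrow> EE (\<lambda>\<omega>. c * X \<omega>) = c * EE X"

definition upper_capacity ::
    "'a measure \<Rightarrow> ('a \<Rightarrow> real) set \<Rightarrow> (('a \<Rightarrow> real) \<Rightarrow> real) \<Rightarrow> 'a set \<Rightarrow> real" where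
  "upper_capacity M H EE A = Inf (EE ` {\<xi> \<in> H. \<forall>\<omega>\<in>space M. indicator A \<omega> \<le> \<xi> \<omega>})"

(* The series may diverge, hence extended nonnegative values. *)
definition outer_capacity ::
    "'a measure \<Rightarrow> ('a \<Rightarrow> real) set \<Rightarrow> (('a \<Rightarrow> real) \<Rightarrow> real) \<Rightarrow> 'a set \<Rightarrow> ennreal" where
  "outer_capacity M H EE A =
     Inf {(\<Sum>n. ennreal (upper_capacity M H EE (B n))) | B. range B \<subseteq> sets M \<and> A \<subseteq> (\<Union>n. B n)}"

(* Nothing in the axioms of a sublinear expectation forces the outer capacity of the
   whole space to be 1: it vanishes for the limit functional on the convergent real
   sequences.  That it is 1, as the word capacity presupposes, is therefore a genuine
   assumption wherever an event is claimed to have outer capacity 1. *)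
lemma outer_capacity_space_can_vanish:
  defines "H \<equiv> {f :: nat \<Rightarrow> real. convergent f}"
  shows "sublinear_expectation_space (count_space UNIV) H lim"
    and "outer_capacity (count_space UNIV) H lim UNIV = 0"
proof -
  show "sublinear_expectation_space (count_space UNIV) H lim"
  proof
    show "H \<subseteq> borel_measurable (count_space UNIV)" by auto
    show "(\<lambda>_. 0) \<in> H" by (simp add: H_def convergent_const)
    show "(\<lambda>\<omega>. X \<omega> + Y \<omega>) \<in> H" if "X \<in> H" "Y \<in> H" for X Y
      using that by (simp add: H_def convergent_add)
    show "(\<lambda>\<omega>. c * X \<omega>) \<in> H" if "X \<in> H" for X c
      using that tendsto_mult_left[of X _ sequentially c] by (auto simp: H_def convergent_def)
    show "lim X \<le> lim Y" if "X \<in> H" "Y \<in> H" "\<And>\<omega>. \<omega> \<in> space (count_space UNIV) \<Longrightarrow> X \<omega> \<le> Y \<omega>" for X Y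
      using that LIMSEQ_le[of X "lim X" Y "lim Y"] by (simp add: H_def convergent_LIMSEQ_iff)
    show "lim (\<lambda>_::nat. c) = c" for c :: real by simp
    show "lim (\<lambda>\<omega>. X \<omega> + Y \<omega>) \<le> lim X + lim Y" if "X \<in> H" "Y \<in> H" for X Y
      using that limI[OF tendsto_add[of X "lim X" sequentially Y "lim Y"]]
      by (simp add: H_def convergent_LIMSEQ_iff)
    show "lim (\<lambda>\<omega>. c * X \<omega>) = c * lim X" if "X \<in> H" for X c
      using that limI[OF tendsto_mult_left[of X "lim X" sequentially c]]
      by (simp add: H_def convergent_LIMSEQ_iff)
    show "(\<lambda>\<omega>. \<phi> (\<lambda>i. X i \<omega>)) \<in> H"
      if "1 \<le> n" and \<phi>: "\<phi> \<in> C_l_Lip n" and X: "\<And>i. i < n \<Longrightarrow> X i \<in> H" for n \<phi> X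
    proof -
      define x where "x i = lim (X i)" for i
      obtain C q where b: "\<And>x y. \<bar>\<phi> x - \<phi> y\<bar> \<le> C * (1 + L2_set x {..<n} ^ q + L2_set y {..<n} ^ q)
          * L2_set (\<lambda>i. x i - y i) {..<n}"
        using \<phi> unfolding C_l_Lip_def by blast
      have lims: "X i \<longlonglongrightarrow> x i" if "i < n" for i
        using X[OF that] by (simp add: H_def convergent_LIMSEQ_iff x_def)
      have "(\<lambda>k. L2_set (\<lambda>i. X i k) {..<n}) \<longlonglongrightarrow> L2_set x {..<n}"
        unfolding L2_set_def by (intro tendsto_intros lims) auto
      moreover have "(\<lambda>k. L2_set (\<lambda>i. X i k - x i) {..<n}) \<longlonglongrightarrow> L2_set (\<lambda>i. x i - x i) {..<n}"
        unfolding L2_set_def by (intro tendsto_intros lims) auto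
      ultimately have "(\<lambda>k. C * (1 + L2_set (\<lambda>i. X i k) {..<n} ^ q + L2_set x {..<n} ^ q)
          * L2_set (\<lambda>i. X i k - x i) {..<n}) \<longlonglongrightarrow>
          C * (1 + L2_set x {..<n} ^ q + L2_set x {..<n} ^ q) * L2_set (\<lambda>i. x i - x i) {..<n}"
        by (intro tendsto_intros)
      then have "(\<lambda>k. C * (1 + L2_set (\<lambda>i. X i k) {..<n} ^ q + L2_set x {..<n} ^ q)
          * L2_set (\<lambda>i. X i k - x i) {..<n}) \<longlonglongrightarrow> 0"
        by (simp add: L2_set_def)
      then have "(\<lambda>k. \<phi> (\<lambda>i. X i k) - \<phi> x) \<longlonglongrightarrow> 0"
        by (rule Lim_null_comparison[rotated]) (auto intro!: always_eventually simp: b)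
      then show ?thesis
        unfolding H_def convergent_def using LIM_zero_iff by blast
    qed
  qed
  have "upper_capacity (count_space UNIV) H lim {n} = 0" for n
  proof -
    have ind: "(indicator {n} :: nat \<Rightarrow> real) \<longlonglongrightarrow> 0"
      by (rule tendsto_eventually) (auto simp: eventually_sequentially indicator_def intro!: exI[of _ "Suc n"])
    show ?thesis
      unfolding upper_capacity_def
    proof (rule cInf_eq_minimum)
      show "0 \<in> lim ` {\<xi> \<in> H. \<forall>\<omega>\<in>space (count_space UNIV). indicator {n} \<omega> \<le> \<xi> \<omega>}"
        using ind limI[OF ind] by (intro image_eqI[of _ _ "indicator {n}"]) (auto simp: H_def convergent_def)
      fix r assume "r \<in> lim ` {\<xi> \<in> H. \<forall>\<omega>\<in>space (count_space UNIV). indicator {n} \<omega> \<le> \<xi> \<omega>}"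
      then obtain \<xi> where "r = lim \<xi>" "\<xi> \<longlonglongrightarrow> lim \<xi>" "\<And>\<omega>. indicator {n} \<omega> \<le> \<xi> \<omega>"
        by (auto simp: H_def convergent_LIMSEQ_iff)
      then show "0 \<le> r"
        using LIMSEQ_le[OF ind, of \<xi> "lim \<xi>"] by auto
    qed
  qed
  then have "0 \<in> {(\<Sum>n. ennreal (upper_capacity (count_space UNIV) H lim (B n))) | B.
      range B \<subseteq> sets (count_space UNIV) \<and> UNIV \<subseteq> (\<Union>n. B n)}"
    by (auto intro!: exI[of _ "\<lambda>n. {n}"])
  then have "outer_capacity (count_space UNIV) H lim UNIV \<le> 0"
    unfolding outer_capacity_def by (rule Inf_lower)
  then show "outer_capacity (count_space UNIV) H lim UNIV = 0" by simp
qed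

end

theory Submission
  imports Defs
begin

text \<open>The hypothesis \<open>EE (X i * X j) = 0\<close> gives no control of \<open>EE (- X i * X j)\<close>, but sums of the \<open>X k\<close> with coefficients 1 still satisfy \<open>EE ((\<Sum>k\<in>J. X k)\<^sup>2) \<le> (\<Sum>k\<in>J. EE ((X k)\<^sup>2))\<close>. The
  Rademacher--Menshov maximal inequality needs no more: every partial sum inside a block of length
  \<open>2 ^ k\<close> is dominated pointwise by a sum of squares of dyadic subsums. Hence on
  \<open>2 ^ k \<le> n < 2 ^ (k + 1)\<close> the square \<open>(S n / n)\<^sup>2\<close> is bounded by twice a random variable \<open>Z k\<close>, and
  \<open>\<Sum>k. EE (Z k) < \<infinity>\<close> by the hypothesis. Chebyshev and Borel--Cantelli for the countably
  subadditive outer capacity show that the divergence event is null.\<close>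

section \<open>Pointwise maximal inequality on a dyadic tree\<close>

text \<open>The nodes of a binary tree of depth \<open>k\<close>: the squared sums over all dyadic
  subintervals of the block \<open>{a..<a + 2 ^ k}\<close>, added up. Since they are added and not
  maximised, \<open>EE\<close> can be estimated node by node through subadditivity.\<close>

fun dyadic_sq :: "(nat \<Rightarrow> real) \<Rightarrow> nat \<Rightarrow> nat \<Rightarrow> real" where
  "dyadic_sq x a 0 = (x a)\<^sup>2"
| "dyadic_sq x a (Suc k) =
     (\<Sum>j\<in>{a..<a + 2 ^ Suc k}. x j)\<^sup>2 + dyadic_sq x a k + dyadic_sq x (a + 2 ^ k) k"

lemma dyadic_sq_nonneg: "0 \<le> dyadic_sq x a k"
  by (induction k arbitrary: a) auto

lemma block_sum_sq_le_dyadic_sq: "(\<Sum>j\<in>{a..<a + 2 ^ k}. x j)\<^sup>2 \<le> dyadic_sq x a k"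
  by (cases k) (auto simp: dyadic_sq_nonneg)

text \<open>The two sides differ by a square divided by \<open>t\<close>. The weight is free:
  \<open>t = real k + 1\<close> balances the induction for the maximal inequality,
  \<open>t = 1\<close> splits a partial sum at the start of its dyadic block.\<close>

lemma sum_sq_le_weighted:
  fixes a b t :: real
  assumes "0 < t"
  shows "(a + b)\<^sup>2 \<le> (1 + t) * (a\<^sup>2 + b\<^sup>2 / t)"
proof -
  have "(1 + t) * (a\<^sup>2 + b\<^sup>2 / t) - (a + b)\<^sup>2 = (t * a - b)\<^sup>2 / t"
    using assms by (simp add: field_simps power2_eq_square)
  moreover have "0 \<le> (t * a - b)\<^sup>2 / t" using assms by simp
  ultimately show ?thesis by linarith
qed

text \<open>A prefix of the block either lies in the left half, or is the full left half followed by
  a prefix of the right half. In the second case the left half is itself a node of the tree and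
  costs only a factor 1, so each halving raises the constant by 1.\<close>

lemma Rademacher_Menshov_pointwise:
  assumes "m \<le> 2 ^ k"
  shows "(\<Sum>j\<in>{a..<a + m}. x j)\<^sup>2 \<le> (real k + 1) * dyadic_sq x a k"
  using assms
proof (induction k arbitrary: a m)
  case 0
  then have "m = 0 \<or> m = 1" by auto
  then show ?case by auto
next
  case (Suc k)
  note nn = dyadic_sq_nonneg[of x]
  show ?case
  proof (cases "m \<le> 2 ^ k")
    case True
    have "(\<Sum>j\<in>{a..<a + m}. x j)\<^sup>2 \<le> (real k + 1) * dyadic_sq x a k"
      by (rule Suc.IH[OF True])
    also have "\<dots> \<le> (real (Suc k) + 1) * dyadic_sq x a (Suc k)"
      using nn[of a k] nn[of "a + 2 ^ k" k] by (intro mult_mono) auto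
    finally show ?thesis .
  next
    case False
    define A where "A = (\<Sum>j\<in>{a..<a + 2 ^ k}. x j)"
    define B where "B = (\<Sum>j\<in>{a + 2 ^ k..<a + 2 ^ k + (m - 2 ^ k)}. x j)"
    have split: "(\<Sum>j\<in>{a..<a + m}. x j) = A + B"
      unfolding A_def B_def using False by (subst sum.atLeastLessThan_concat) auto
    have "B\<^sup>2 \<le> (real k + 1) * dyadic_sq x (a + 2 ^ k) k"
      unfolding B_def by (rule Suc.IH) (use Suc.prems in auto)
    then have B: "B\<^sup>2 / (real k + 1) \<le> dyadic_sq x (a + 2 ^ k) k"
      by (simp add: divide_le_eq mult.commute)
    have A: "A\<^sup>2 \<le> dyadic_sq x a k"
      unfolding A_def by (rule block_sum_sq_le_dyadic_sq)
    \<comment> \<open>The weight \<open>t = real k + 1\<close> cancels the factor that the induction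
      hypothesis puts on \<open>B\<^sup>2\<close>, and leaves \<open>1 + t\<close>, the constant of
      the next level, in front.\<close>
    have "(A + B)\<^sup>2 \<le> (1 + (real k + 1)) * (A\<^sup>2 + B\<^sup>2 / (real k + 1))"
      by (rule sum_sq_le_weighted) simp
    also have "\<dots> \<le> (1 + (real k + 1)) * dyadic_sq x a (Suc k)"
    proof (rule mult_left_mono)
      have "A\<^sup>2 + B\<^sup>2 / (real k + 1) \<le> dyadic_sq x a k + dyadic_sq x (a + 2 ^ k) k"
        using A B by linarith
      also have "\<dots> \<le> dyadic_sq x a (Suc k)" by simp
      finally show "A\<^sup>2 + B\<^sup>2 / (real k + 1) \<le> dyadic_sq x a (Suc k)" .
    qed simp
    finally show ?thesis by (simp add: split add_ac)
  qed
qed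

section \<open>Real sequences and series along dyadic blocks\<close>

lemma dyadic_partition:
  fixes n :: nat
  assumes "1 \<le> n"
  obtains k where "2 ^ k \<le> n" "n < 2 ^ Suc k"
  using ex_power_ivl1[of 2 n] assms by auto

lemma tendsto_zero_if_dyadic_bound:
  fixes s z :: "nat \<Rightarrow> real"
  assumes bound: "\<And>k n. 2 ^ k \<le> n \<Longrightarrow> n < 2 ^ Suc k \<Longrightarrow> (s n)\<^sup>2 \<le> z k"
    and z: "z \<longlonglongrightarrow> 0"
  shows "s \<longlonglongrightarrow> 0"
proof (rule LIMSEQ_I)
  fix e :: real assume e: "0 < e"
  with z have "eventually (\<lambda>k. z k < e\<^sup>2) sequentially"
    by (intro order_tendstoD) auto
  then obtain K where K: "\<And>k. K \<le> k \<Longrightarrow> z k < e\<^sup>2"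
    by (auto simp: eventually_sequentially)
  have "norm (s n - 0) < e" if n: "2 ^ K \<le> n" for n
  proof -
    have "1 \<le> n" using n one_le_power[of "2::nat" K] by linarith
    then obtain k where k: "2 ^ k \<le> n" "n < 2 ^ Suc k" by (rule dyadic_partition)
    \<comment> \<open>The block containing \<open>n\<close> does not precede block \<open>K\<close>,
      so \<open>z k\<close> is already small.\<close>
    have "(2::nat) ^ K < 2 ^ Suc k" using n k by linarith
    then have "K \<le> k" by (simp only: power_strict_increasing_iff)
    then have "(s n)\<^sup>2 < e\<^sup>2" using bound[OF k] K by force
    then show ?thesis using e power2_less_imp_less[of "\<bar>s n\<bar>" e] by simp
  qed
  then show "\<exists>no. \<forall>n\<ge>no. norm (s n - 0) < e" by blast
qed

text \<open>If U is the sum of \<open>u k\<close> over \<open>k \<le> n\<close>, adding up the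
  recursion gives U \<le> \<open>u 0\<close> + U / 4 + \<open>suminf v\<close>. Absorbing U / 4
  bounds U by 4/3 times \<open>u 0 + suminf v\<close>; the bound uses 2 as a round constant above
  4/3.\<close>

lemma summable_quarter_recursion:
  fixes u v :: "nat \<Rightarrow> real"
  assumes nn: "\<And>k. 0 \<le> u k" "\<And>k. 0 \<le> v k"
    and rec: "\<And>k. u (Suc k) \<le> u k / 4 + v k"
    and v: "summable v"
  shows "summable u"
proof (rule bounded_imp_summable[where B = "2 * (u 0 + suminf v)"])
  fix n
  have "(\<Sum>k\<le>n. u k) \<le> u 0 + (\<Sum>k<n. u (Suc k))"
    by (metis order_refl sum.lessThan_Suc_shift lessThan_Suc_atMost)
  also have "\<dots> \<le> u 0 + (\<Sum>k<n. u k / 4 + v k)"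
    by (intro add_left_mono sum_mono rec)
  also have "\<dots> = u 0 + (\<Sum>k<n. u k) / 4 + (\<Sum>k<n. v k)"
    by (simp add: sum.distrib sum_divide_distrib)
  also have "\<dots> \<le> u 0 + (\<Sum>k\<le>n. u k) / 4 + suminf v"
  proof -
    have "(\<Sum>k<n. u k) \<le> (\<Sum>k\<le>n. u k)" by (intro sum_mono2) (auto simp: nn)
    moreover have "(\<Sum>k<n. v k) \<le> suminf v" by (intro sum_le_suminf v) (auto simp: nn)
    ultimately show ?thesis by simp
  qed
  finally show "(\<Sum>k\<le>n. u k) \<le> 2 * (u 0 + suminf v)"
    using sum_nonneg[of "{..n}" u] nn suminf_nonneg[OF v] by (simp add: field_simps)
qed (rule nn)

text \<open>Block sums are increments of the partial sums of \<open>c\<close> along the powers of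
  two, a convergent subsequence, so their series telescopes.\<close>

lemma summable_dyadic_blocks:
  fixes c :: "nat \<Rightarrow> real"
  assumes "summable c"
  shows "summable (\<lambda>k. \<Sum>j\<in>{2 ^ k..<2 ^ Suc k}. c j)"
proof -
  have lim: "(\<lambda>k. \<Sum>j<2 ^ k. c j) \<longlonglongrightarrow> suminf c"
    using summable_LIMSEQ[OF assms]
    by (rule filterlim_compose) (auto intro!: filterlim_subseq simp: strict_mono_def)
  have "(\<Sum>j\<in>{2 ^ k..<2 ^ Suc k}. c j) = (\<Sum>j<2 ^ Suc k. c j) - (\<Sum>j<2 ^ k. c j)" for k
    using sum.atLeastLessThan_concat[of 0 "2 ^ k" "2 ^ Suc k" c]
    by (simp add: atLeast0LessThan)
  then show ?thesis using telescope_summable[OF lim] by simp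
qed

text \<open>For \<open>j\<close> in block \<open>k\<close> the numbers \<open>2 ^ k\<close> and
  \<open>j\<close> agree up to a factor 2, and \<open>log 2 (real j)\<close> is at least
  \<open>real k\<close>. Of the constant 16, one factor 4 comes from squaring
  \<open>real k + 1 \<le> 2 * log 2 (real j)\<close>, the other from squaring
  \<open>real j \<le> 2 * 2 ^ k\<close>.\<close>

lemma summable_log_weighted_blocks:
  fixes b :: "nat \<Rightarrow> real"
  assumes nn: "\<And>j. 1 \<le> j \<Longrightarrow> 0 \<le> b j"
    and c: "summable (\<lambda>j. b j / (real j)\<^sup>2 * (log 2 (real j))\<^sup>2)"
  shows "summable (\<lambda>k. (real k + 1)\<^sup>2 * (\<Sum>j\<in>{2 ^ k..<2 ^ Suc k}. b j) / 4 ^ k)"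
proof -
  let ?c = "\<lambda>j. b j / (real j)\<^sup>2 * (log 2 (real j))\<^sup>2"
  \<comment> \<open>Block 0 consists of \<open>j = 1\<close> alone, where the logarithm vanishes and
    nothing can be dominated; the comparison therefore starts at \<open>k = 1\<close>.\<close>
  have "norm ((real k + 1)\<^sup>2 * (\<Sum>j\<in>{2 ^ k..<2 ^ Suc k}. b j) / 4 ^ k)
      \<le> 16 * (\<Sum>j\<in>{2 ^ k..<2 ^ Suc k}. ?c j)" if k: "1 \<le> k" for k
  proof -
    have term_le: "(real k + 1)\<^sup>2 / 4 ^ k * b j \<le> 16 * ?c j" "0 \<le> b j" if j: "j \<in> {2 ^ k..<2 ^ Suc k}" for j
    proof -
      have j1: "1 \<le> j" using j one_le_power[of "2::nat" k] by auto
      then show b: "0 \<le> b j" by (rule nn)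
      have jk: "2 ^ k \<le> real j" using j by (metis atLeastLessThan_iff of_nat_le_iff of_nat_numeral of_nat_power)
      have "real k \<le> log 2 (real j)"
        using jk j1 by (simp add: le_log_iff powr_realpow)
      then have "real k + 1 \<le> 2 * log 2 (real j)" using k by linarith
      then have l: "(real k + 1)\<^sup>2 \<le> 4 * (log 2 (real j))\<^sup>2"
        using power_mono[of "real k + 1" "2 * log 2 (real j)" 2] by (simp add: power_mult_distrib)
      have "real j \<le> 2 * 2 ^ k"
        using j by (metis atLeastLessThan_iff less_imp_le of_nat_le_iff of_nat_numeral of_nat_power power_Suc)
      then have "(real j)\<^sup>2 \<le> (2 * 2 ^ k)\<^sup>2" by (intro power_mono) auto
      also have "\<dots> = 4 * 4 ^ k" by (simp add: power2_eq_square flip: power_mult_distrib)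
      finally have "1 / 4 ^ k \<le> 4 / (real j)\<^sup>2" using j1 by (simp add: field_simps)
      from mult_mono[OF l this] have "(real k + 1)\<^sup>2 / 4 ^ k \<le> 16 * (log 2 (real j))\<^sup>2 / (real j)\<^sup>2"
        by simp
      from mult_right_mono[OF this b] show "(real k + 1)\<^sup>2 / 4 ^ k * b j \<le> 16 * ?c j"
        by (simp add: mult_ac)
    qed
    have "(real k + 1)\<^sup>2 * (\<Sum>j\<in>{2 ^ k..<2 ^ Suc k}. b j) / 4 ^ k
        = (\<Sum>j\<in>{2 ^ k..<2 ^ Suc k}. (real k + 1)\<^sup>2 / 4 ^ k * b j)"
      by (simp add: sum_distrib_left sum_divide_distrib)
    also have "\<dots> \<le> 16 * (\<Sum>j\<in>{2 ^ k..<2 ^ Suc k}. ?c j)"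
      unfolding sum_distrib_left by (intro sum_mono term_le)
    finally show ?thesis
      using sum_nonneg[of "{2 ^ k..<2 ^ Suc k}" b] term_le(2) by simp
  qed
  then show ?thesis
    by (intro summable_comparison_test[OF _ summable_mult[OF summable_dyadic_blocks[OF c], of 16]]) blast
qed

section \<open>Closure properties of \<open>H\<close> and second moments of sums\<close>

context sublinear_expectation_space
begin

lemma const_mem: "(\<lambda>_. c) \<in> H"
proof -
  have "(\<lambda>_. c) \<in> C_l_Lip 1"
    unfolding C_l_Lip_def by (auto intro!: exI[of _ 1] simp: L2_set_nonneg)
  from C_l_Lip_mem[OF order_refl this, of "\<lambda>_ _. 0"] show ?thesis by (simp add: zero_mem)
qed

text \<open>The product of two coordinates lies in \<open>C_l_Lip 2\<close> with constant 1 and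
  exponent 1: change one factor at a time and bound each coordinate by the Euclidean norm.\<close>

lemma mult_mem:
  assumes "X \<in> H" "Y \<in> H"
  shows "(\<lambda>\<omega>. X \<omega> * Y \<omega>) \<in> H"
proof -
  let ?N = "\<lambda>x::nat \<Rightarrow> real. L2_set x {..<2::nat}"
  have le: "\<bar>x i\<bar> \<le> ?N x" if "i < 2" for x i
    using member_le_L2_set[of "{..<2}" i "\<lambda>i. \<bar>x i\<bar>"] that by (simp add: L2_set_def)
  have "\<bar>x 0 * x 1 - y 0 * y 1\<bar> \<le> 1 * (1 + ?N x ^ 1 + ?N y ^ 1) * ?N (\<lambda>i. x i - y i)" for x y
  proof -
    have "\<bar>x 0 * x 1 - y 0 * y 1\<bar> = \<bar>x 0 * (x 1 - y 1) + y 1 * (x 0 - y 0)\<bar>"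
      by (simp add: algebra_simps)
    also have "\<dots> \<le> \<bar>x 0\<bar> * \<bar>x 1 - y 1\<bar> + \<bar>y 1\<bar> * \<bar>x 0 - y 0\<bar>"
      by (metis abs_mult abs_triangle_ineq)
    also have "\<dots> \<le> ?N x * ?N (\<lambda>i. x i - y i) + ?N y * ?N (\<lambda>i. x i - y i)"
      using le[of 0 "\<lambda>i. x i - y i"] le[of 1 "\<lambda>i. x i - y i"] le[of 0 x] le[of 1 y]
      by (intro add_mono mult_mono) (auto simp: L2_set_nonneg)
    also have "\<dots> \<le> 1 * (1 + ?N x ^ 1 + ?N y ^ 1) * ?N (\<lambda>i. x i - y i)"
      by (simp add: algebra_simps L2_set_nonneg)
    finally show ?thesis .
  qed
  then have "(\<lambda>x. x 0 * x 1) \<in> C_l_Lip 2"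
    unfolding C_l_Lip_def by (intro CollectI exI[of _ 1] exI[of _ "1::nat"] conjI allI) auto
  from C_l_Lip_mem[OF _ this, of "\<lambda>i. if i = 0 then X else Y"] show ?thesis
    using assms by simp
qed

lemma square_mem: "X \<in> H \<Longrightarrow> (\<lambda>\<omega>. (X \<omega>)\<^sup>2) \<in> H"
  by (simp add: power2_eq_square mult_mem)

lemma sum_mem:
  assumes "\<And>j. j \<in> J \<Longrightarrow> X j \<in> H"
  shows "(\<lambda>\<omega>. \<Sum>j\<in>J. X j \<omega>) \<in> H"
  using assms by (induction J rule: infinite_finite_induct) (auto simp: zero_mem add_mem)

lemma expectation_nonneg:
  assumes "X \<in> H" "\<And>\<omega>. \<omega> \<in> space M \<Longrightarrow> 0 \<le> X \<omega>"
  shows "0 \<le> EE X"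
  using mono[OF zero_mem assms(1)] assms(2) const[of 0] by simp

lemma expectation_sum_le:
  assumes "\<And>j. j \<in> J \<Longrightarrow> X j \<in> H"
  shows "EE (\<lambda>\<omega>. \<Sum>j\<in>J. X j \<omega>) \<le> (\<Sum>j\<in>J. EE (X j))"
  using assms
proof (induction J rule: infinite_finite_induct)
  case (insert i J)
  have "EE (\<lambda>\<omega>. X i \<omega> + (\<Sum>j\<in>J. X j \<omega>)) \<le> EE (X i) + EE (\<lambda>\<omega>. \<Sum>j\<in>J. X j \<omega>)"
    using insert.prems by (intro subadd sum_mem) auto
  with insert show ?case by force
qed (auto simp: const)

text \<open>In the expanded square every cross term has the positive coefficient 2. Positive
  homogeneity then turns orthogonality into expectation 0 for each cross term, and subadditivity
  makes their sum at most 0.\<close>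

lemma expectation_square_sum_le:
  assumes "finite J"
    and "\<And>j. j \<in> J \<Longrightarrow> X j \<in> H"
    and "\<And>i j. i \<in> J \<Longrightarrow> j \<in> J \<Longrightarrow> i \<noteq> j \<Longrightarrow> EE (\<lambda>\<omega>. X i \<omega> * X j \<omega>) = 0"
  shows "EE (\<lambda>\<omega>. (\<Sum>j\<in>J. X j \<omega>)\<^sup>2) \<le> (\<Sum>j\<in>J. EE (\<lambda>\<omega>. (X j \<omega>)\<^sup>2))"
  using assms
proof (induction J rule: finite_induct)
  case (insert i J)
  let ?S = "\<lambda>\<omega>. \<Sum>j\<in>J. X j \<omega>" and ?C = "\<lambda>\<omega>. \<Sum>j\<in>J. 2 * (X i \<omega> * X j \<omega>)"
  have mem: "X i \<in> H" "?S \<in> H" "\<And>j. j \<in> J \<Longrightarrow> (\<lambda>\<omega>. X i \<omega> * X j \<omega>) \<in> H" "?C \<in> H"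
    using insert.prems by (auto intro!: sum_mem scale_mem mult_mem)
  have C: "EE ?C \<le> 0"
  proof -
    have "EE ?C \<le> (\<Sum>j\<in>J. EE (\<lambda>\<omega>. 2 * (X i \<omega> * X j \<omega>)))"
      by (intro expectation_sum_le scale_mem mem)
    also have "\<dots> = (\<Sum>j\<in>J. 2 * EE (\<lambda>\<omega>. X i \<omega> * X j \<omega>))"
      by (intro sum.cong refl pos_homogeneous mem) auto
    also have "\<dots> = 0" using insert by (intro sum.neutral) auto
    finally show ?thesis .
  qed
  have "(\<lambda>\<omega>. (\<Sum>j\<in>insert i J. X j \<omega>)\<^sup>2) = (\<lambda>\<omega>. (X i \<omega>)\<^sup>2 + (?C \<omega> + (?S \<omega>)\<^sup>2))"
    using insert.hyps by (auto simp: power2_sum sum_distrib_left mult_ac)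
  then have "EE (\<lambda>\<omega>. (\<Sum>j\<in>insert i J. X j \<omega>)\<^sup>2) \<le> EE (\<lambda>\<omega>. (X i \<omega>)\<^sup>2) + EE (\<lambda>\<omega>. ?C \<omega> + (?S \<omega>)\<^sup>2)"
    by (simp only:) (intro subadd square_mem add_mem mem)
  also have "EE (\<lambda>\<omega>. ?C \<omega> + (?S \<omega>)\<^sup>2) \<le> EE ?C + EE (\<lambda>\<omega>. (?S \<omega>)\<^sup>2)"
    by (intro subadd square_mem mem)
  also have "EE (\<lambda>\<omega>. (?S \<omega>)\<^sup>2) \<le> (\<Sum>j\<in>J. EE (\<lambda>\<omega>. (X j \<omega>)\<^sup>2))"
    using insert by auto
  finally show ?case using C insert.hyps by simp
qed (simp add: const)

lemma dyadic_sq_mem: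
  assumes "\<And>j. a \<le> j \<Longrightarrow> X j \<in> H"
  shows "(\<lambda>\<omega>. dyadic_sq (\<lambda>j. X j \<omega>) a k) \<in> H"
  using assms
proof (induction k arbitrary: a)
  case (Suc k)
  then show ?case by (auto intro!: add_mem square_mem sum_mem)
qed (auto intro: square_mem)

text \<open>The tree has \<open>k + 1\<close> levels, and the intervals of each level partition the
  block. By orthogonality each level contributes at most the sum of the second moments over the
  block.\<close>

lemma expectation_dyadic_sq_le:
  assumes "\<And>j. a \<le> j \<Longrightarrow> X j \<in> H"
    and "\<And>i j. a \<le> i \<Longrightarrow> a \<le> j \<Longrightarrow> i \<noteq> j \<Longrightarrow> EE (\<lambda>\<omega>. X i \<omega> * X j \<omega>) = 0"
  shows "EE (\<lambda>\<omega>. dyadic_sq (\<lambda>j. X j \<omega>) a k) \<le> (real k + 1) * (\<Sum>j\<in>{a..<a + 2 ^ k}. EE (\<lambda>\<omega>. (X j \<omega>)\<^sup>2))"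
  using assms
proof (induction k arbitrary: a)
  case (Suc k)
  let ?b = "\<lambda>j. EE (\<lambda>\<omega>. (X j \<omega>)\<^sup>2)"
  let ?Q = "\<lambda>\<omega>. (\<Sum>j\<in>{a..<a + 2 ^ Suc k}. X j \<omega>)\<^sup>2"
  let ?L = "\<lambda>\<omega>. dyadic_sq (\<lambda>j. X j \<omega>) a k" and ?R = "\<lambda>\<omega>. dyadic_sq (\<lambda>j. X j \<omega>) (a + 2 ^ k) k"
  have mem: "?Q \<in> H" "?L \<in> H" "?R \<in> H"
    using Suc.prems by (auto intro!: square_mem sum_mem dyadic_sq_mem)
  have "EE (\<lambda>\<omega>. ?Q \<omega> + ?L \<omega> + ?R \<omega>) \<le> EE (\<lambda>\<omega>. ?Q \<omega> + ?L \<omega>) + EE ?R"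
    by (intro subadd add_mem mem)
  also have "EE (\<lambda>\<omega>. ?Q \<omega> + ?L \<omega>) \<le> EE ?Q + EE ?L"
    by (intro subadd mem)
  also have "EE ?Q \<le> sum ?b {a..<a + 2 ^ Suc k}"
    using Suc.prems by (intro expectation_square_sum_le) auto
  also have "EE ?L \<le> (real k + 1) * sum ?b {a..<a + 2 ^ k}"
    using Suc.prems by (intro Suc.IH) auto
  also have "EE ?R \<le> (real k + 1) * sum ?b {a + 2 ^ k..<a + 2 ^ k + 2 ^ k}"
    using Suc.prems by (intro Suc.IH) auto
  finally have "EE (\<lambda>\<omega>. ?Q \<omega> + ?L \<omega> + ?R \<omega>) \<le> sum ?b {a..<a + 2 ^ Suc k}
      + (real k + 1) * (sum ?b {a..<a + 2 ^ k} + sum ?b {a + 2 ^ k..<a + 2 ^ k + 2 ^ k})"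
    by (simp add: algebra_simps)
  also have "sum ?b {a..<a + 2 ^ k} + sum ?b {a + 2 ^ k..<a + 2 ^ k + 2 ^ k} = sum ?b {a..<a + 2 ^ Suc k}"
    by (subst sum.atLeastLessThan_concat) (auto simp: mult_2 add.assoc)
  finally show ?case by (simp add: algebra_simps)
qed auto

section \<open>The outer capacity: countable subadditivity and Borel-Cantelli\<close>

abbreviation "outer \<equiv> outer_capacity M H EE"

text \<open>The infimum is taken in the reals, so a lower bound must be exhibited: a random variable
  above an indicator is nonnegative on \<open>space M\<close>, hence has nonnegative
  expectation.\<close>

lemma upper_capacity_le:
  assumes "\<xi> \<in> H" "\<And>\<omega>. \<omega> \<in> space M \<Longrightarrow> indicator A \<omega> \<le> \<xi> \<omega>"
  shows "upper_capacity M H EE A \<le> EE \<xi>"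
  unfolding upper_capacity_def
proof (rule cInf_lower)
  have nn: "0 \<le> \<xi> \<omega>" if "\<forall>\<omega>\<in>space M. indicator A \<omega> \<le> \<xi> \<omega>" "\<omega> \<in> space M" for \<xi> :: "'a \<Rightarrow> real" and \<omega>
    using that order_trans[of 0 "indicator A \<omega>" "\<xi> \<omega>"] by simp
  show "bdd_below (EE ` {\<xi> \<in> H. \<forall>\<omega>\<in>space M. indicator A \<omega> \<le> \<xi> \<omega>})"
    by (rule bdd_belowI[of _ 0]) (auto simp: nn intro!: expectation_nonneg)
qed (use assms in auto)

text \<open>The competitor \<open>\<xi> = 0\<close> gives the upper bound 0, and
  \<open>ennreal\<close> sends every real that is at most 0 to 0.\<close>

lemma upper_capacity_empty: "ennreal (upper_capacity M H EE {}) = 0"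
  using upper_capacity_le[OF zero_mem, of "{}"] const[of 0] by (simp add: ennreal_neg)

lemma outer_capacity_le:
  assumes "range B \<subseteq> sets M" "A \<subseteq> (\<Union>n. B n)"
  shows "outer A \<le> (\<Sum>n. ennreal (upper_capacity M H EE (B n)))"
  unfolding outer_capacity_def using assms by (intro Inf_lower) auto

lemma outer_capacity_mono:
  assumes "A \<subseteq> B"
  shows "outer A \<le> outer B"
proof (unfold outer_capacity_def[of M H EE B], rule Inf_greatest, clarify)
  fix C :: "nat \<Rightarrow> 'a set" assume "range C \<subseteq> sets M" "B \<subseteq> (\<Union>n. C n)"
  with assms show "outer A \<le> (\<Sum>n. ennreal (upper_capacity M H EE (C n)))"
    by (intro outer_capacity_le) auto
qed

lemma outer_capacity_empty: "outer {} = 0"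
  using outer_capacity_le[of "\<lambda>_. {}" "{}"] by (simp add: upper_capacity_empty)

text \<open>The usual outer measure argument: cover each \<open>A n\<close> up to an error
  \<open>e / 2 ^ (n + 1)\<close> and merge the double family of covers into one sequence.\<close>

lemma outer_capacity_countably_subadditive: "outer (\<Union>n. A n) \<le> (\<Sum>n. outer (A n))"
proof (rule ennreal_le_epsilon)
  fix e :: real assume fin: "(\<Sum>n. outer (A n)) < top" and e: "0 < e"
  let ?V = "\<lambda>B. ennreal (upper_capacity M H EE B)"
  let ?e = "\<lambda>n. ennreal (e * (1 / 2) ^ Suc n)"
  have "\<exists>B. range B \<subseteq> sets M \<and> A n \<subseteq> (\<Union>m. B m) \<and> (\<Sum>m. ?V (B m)) \<le> outer (A n) + ?e n" for n
  proof -
    have "outer (A n) \<le> (\<Sum>n. outer (A n))"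
      using sum_le_suminf[of "\<lambda>n. outer (A n)" "{n}"] by simp
    \<comment> \<open>Strictness rests on \<open>outer (A n)\<close> being finite, which follows
      from the finite total. It places the infimum strictly below the right side, so that some cover
      realises the bound.\<close>
    then have "outer (A n) < outer (A n) + ?e n"
      proof -
      have "outer (A n) \<noteq> top" using \<open>outer (A n) \<le> (\<Sum>n. outer (A n))\<close> fin
        by (auto simp: top_unique)
      moreover have "0 < ?e n" using e by simp
      ultimately have "outer (A n) + 0 < outer (A n) + ?e n"
        by (simp add: ennreal_add_left_cancel_less del: add.right_neutral)
      then show ?thesis by simp
    qed
    then show ?thesis
      unfolding outer_capacity_def[of M H EE "A n"] Inf_less_iff by (auto intro: less_imp_le)
  qed
  then obtain B where B: "\<And>n. range (B n) \<subseteq> sets M" "\<And>n. A n \<subseteq> (\<Union>m. B n m)"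
      "\<And>n. (\<Sum>m. ?V (B n m)) \<le> outer (A n) + ?e n"
    by metis
  have "outer (\<Union>n. A n) \<le> (\<Sum>i. ?V (case_prod B (prod_decode i)))"
  proof (rule outer_capacity_le)
    show "range (\<lambda>i. case_prod B (prod_decode i)) \<subseteq> sets M"
      using B(1) by (auto split: prod.split)
    show "(\<Union>n. A n) \<subseteq> (\<Union>i. case_prod B (prod_decode i))"
    proof
      fix \<omega> assume "\<omega> \<in> (\<Union>n. A n)"
      then obtain n m where "\<omega> \<in> B n m" using B(2) by blast
      then show "\<omega> \<in> (\<Union>i. case_prod B (prod_decode i))"
        by (intro UN_I[of "prod_encode (n, m)"]) simp_all
    qed
  qed
  also have "\<dots> = (\<Sum>n. \<Sum>m. ?V (B n m))"
    using suminf_ennreal_2dimen[of "\<lambda>n. \<Sum>m. ?V (B n m)" "\<lambda>p. ?V (case_prod B p)"]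
    by (simp add: comp_def)
  also have "\<dots> \<le> (\<Sum>n. outer (A n) + ?e n)"
    by (intro suminf_le B) auto
  also have "\<dots> = (\<Sum>n. outer (A n)) + (\<Sum>n. ?e n)"
    by (rule suminf_add[symmetric]) auto
  also have "(\<Sum>n. ?e n) = ennreal e"
  proof -
    have "(\<lambda>n. e * (1 / 2) ^ Suc n) sums (e * 1)"
      by (intro sums_mult power_half_series)
    then show ?thesis using e by (intro suminf_ennreal_eq) auto
  qed
  finally show "outer (\<Union>n. A n) \<le> (\<Sum>n. outer (A n)) + ennreal e" .
qed

lemma outer_capacity_subadditive: "outer (A \<union> B) \<le> outer A + outer B"
proof -
  let ?F = "\<lambda>n::nat. if n = 0 then A else if n = 1 then B else {}"
  have "A = ?F 0" "B = ?F 1" by simp_all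
  then have "A \<union> B \<subseteq> (\<Union>n. ?F n)" by blast
  then have "outer (A \<union> B) \<le> (\<Sum>n. outer (?F n))"
    using outer_capacity_mono outer_capacity_countably_subadditive[of ?F] order_trans by blast
  also have "\<dots> = (\<Sum>n\<in>{0, 1}. outer (?F n))"
    by (rule suminf_finite) (auto simp: outer_capacity_empty)
  finally show ?thesis by simp
qed

text \<open>The random variable \<open>Z / e\<close> dominates the indicator of the event.\<close>

lemma upper_capacity_Chebyshev:
  assumes "Z \<in> H" "\<And>\<omega>. \<omega> \<in> space M \<Longrightarrow> 0 \<le> Z \<omega>" "0 < e"
  shows "upper_capacity M H EE {\<omega> \<in> space M. e \<le> Z \<omega>} \<le> EE Z / e"
proof -
  have "upper_capacity M H EE {\<omega> \<in> space M. e \<le> Z \<omega>} \<le> EE (\<lambda>\<omega>. (1 / e) * Z \<omega>)"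
    using assms by (intro upper_capacity_le scale_mem) (auto simp: indicator_def)
  also have "\<dots> = EE Z / e" using pos_homogeneous[OF assms(1), of "1 / e"] assms(3) by simp
  finally show ?thesis .
qed

text \<open>For every \<open>N\<close> the events \<open>e \<le> Z (k + N) \<omega>\<close> cover
  the limsup event and are admissible in the definition of \<open>outer\<close>. By Chebyshev the
  cover costs at most a tail of a convergent series.\<close>

lemma Borel_Cantelli:
  assumes Z: "\<And>k. Z k \<in> H" "\<And>k \<omega>. \<omega> \<in> space M \<Longrightarrow> 0 \<le> Z k \<omega>"
    and sum: "summable (\<lambda>k. EE (Z k))"
    and e: "0 < e"
  shows "outer {\<omega> \<in> space M. \<exists>\<^sub>\<infinity>k. e \<le> Z k \<omega>} = 0"
proof -
  have le: "outer {\<omega> \<in> space M. \<exists>\<^sub>\<infinity>k. e \<le> Z k \<omega>} \<le> ennreal (\<Sum>k. EE (Z (k + N)) / e)" for N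
  proof -
    let ?B = "\<lambda>k. {\<omega> \<in> space M. e \<le> Z (k + N) \<omega>}"
    have "outer {\<omega> \<in> space M. \<exists>\<^sub>\<infinity>k. e \<le> Z k \<omega>} \<le> (\<Sum>k. ennreal (upper_capacity M H EE (?B k)))"
    proof (rule outer_capacity_le)
      have "Z k \<in> borel_measurable M" for k using Z(1) measurable by blast
      then show "range ?B \<subseteq> sets M" by (auto intro!: borel_measurable_le)
      show "{\<omega> \<in> space M. \<exists>\<^sub>\<infinity>k. e \<le> Z k \<omega>} \<subseteq> (\<Union>k. ?B k)"
        by (auto simp: INFM_nat_le) (metis le_add_diff_inverse2)
    qed
    also have "\<dots> \<le> (\<Sum>k. ennreal (EE (Z (k + N)) / e))"
      by (intro suminf_le ennreal_leI upper_capacity_Chebyshev Z e) auto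
    also have "\<dots> = ennreal (\<Sum>k. EE (Z (k + N)) / e)"
      using Z e sum
      by (intro suminf_ennreal2 divide_nonneg_pos expectation_nonneg summable_divide
          summable_ignore_initial_segment) auto
    finally show ?thesis .
  qed
  have "(\<lambda>N. \<Sum>k. EE (Z (k + N)) / e) \<longlonglongrightarrow> 0"
    using suminf_exist_split2[OF summable_divide[OF sum, of e]] .
  then have "(\<lambda>N. ennreal (\<Sum>k. EE (Z (k + N)) / e)) \<longlonglongrightarrow> ennreal 0"
    by (rule tendsto_ennrealI)
  then have "outer {\<omega> \<in> space M. \<exists>\<^sub>\<infinity>k. e \<le> Z k \<omega>} \<le> ennreal 0"
    by (rule LIMSEQ_le_const) (use le in auto)
  then show ?thesis by simp
qed

text \<open>Failure of convergence to 0 means that some threshold \<open>1 / (real m + 1)\<close> is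
  reached infinitely often, a countable union of null events.\<close>

lemma outer_capacity_not_tendsto_zero:
  assumes Z: "\<And>k. Z k \<in> H" "\<And>k \<omega>. \<omega> \<in> space M \<Longrightarrow> 0 \<le> Z k \<omega>"
    and sum: "summable (\<lambda>k. EE (Z k))"
  shows "outer {\<omega> \<in> space M. \<not> (\<lambda>k. Z k \<omega>) \<longlonglongrightarrow> 0} = 0"
proof -
  let ?L = "\<lambda>m::nat. {\<omega> \<in> space M. \<exists>\<^sub>\<infinity>k. 1 / (real m + 1) \<le> Z k \<omega>}"
  have "{\<omega> \<in> space M. \<not> (\<lambda>k. Z k \<omega>) \<longlonglongrightarrow> 0} \<subseteq> (\<Union>m. ?L m)"
  proof (rule subsetI, rule ccontr)
    fix \<omega> assume "\<omega> \<in> {\<omega> \<in> space M. \<not> (\<lambda>k. Z k \<omega>) \<longlonglongrightarrow> 0}" and notin: "\<omega> \<notin> (\<Union>m. ?L m)"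
    then have \<omega>: "\<omega> \<in> space M" and n: "\<not> (\<lambda>k. Z k \<omega>) \<longlonglongrightarrow> 0" by auto
    have "(\<lambda>k. Z k \<omega>) \<longlonglongrightarrow> 0"
    proof (rule LIMSEQ_I)
      fix r :: real assume "0 < r"
      then obtain m where m: "1 / (real m + 1) < r"
        using reals_Archimedean[of r] by (auto simp: inverse_eq_divide add.commute)
      from notin \<omega> have "\<exists>N. \<forall>k\<ge>N. Z k \<omega> < 1 / (real m + 1)"
        unfolding INFM_nat_le by (simp add: not_le) (meson not_le)
      with m Z(2)[OF \<omega>] show "\<exists>no. \<forall>k\<ge>no. norm (Z k \<omega> - 0) < r" by fastforce
    qed
    with n show False ..
  qed
  then have "outer {\<omega> \<in> space M. \<not> (\<lambda>k. Z k \<omega>) \<longlonglongrightarrow> 0} \<le> (\<Sum>m. outer (?L m))"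
    using outer_capacity_mono outer_capacity_countably_subadditive[of ?L] order_trans by blast
  also have "\<dots> = 0" using Borel_Cantelli[OF Z sum] by simp
  finally show ?thesis by simp
qed

section \<open>Random variables dominating the averages on dyadic blocks\<close>

lemma dyadic_dominating_sequence:
  assumes X: "\<And>n. 1 \<le> n \<Longrightarrow> X n \<in> H"
    and orth: "\<And>i j. 1 \<le> i \<Longrightarrow> 1 \<le> j \<Longrightarrow> i \<noteq> j \<Longrightarrow> EE (\<lambda>\<omega>. X i \<omega> * X j \<omega>) = 0"
    and sum: "summable (\<lambda>k. EE (\<lambda>\<omega>. (X k \<omega>)\<^sup>2) / (real k)\<^sup>2 * (log 2 (real k))\<^sup>2)"
  obtains Z where "\<And>k. Z k \<in> H" "\<And>k \<omega>. 0 \<le> Z k \<omega>" "summable (\<lambda>k. EE (Z k))"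
    "\<And>k n \<omega>. 2 ^ k \<le> n \<Longrightarrow> n < 2 ^ Suc k \<Longrightarrow> ((\<Sum>j=1..n. X j \<omega>) / real n)\<^sup>2 \<le> 2 * Z k \<omega>"
proof
  \<comment> \<open>\<open>T k\<close> is the squared partial sum just before block
    \<open>k\<close>, and \<open>D k\<close> controls the fluctuation inside the block. After
    division by \<open>4 ^ k\<close>, \<open>u k\<close> and \<open>v k\<close> are to bound the
    expectations of these two parts of \<open>Z k\<close>.\<close>
  define b where "b j = EE (\<lambda>\<omega>. (X j \<omega>)\<^sup>2)" for j
  define T where "T k \<omega> = (\<Sum>j\<in>{1..<2 ^ k}. X j \<omega>)\<^sup>2" for k :: nat and \<omega>
  define D where "D k \<omega> = dyadic_sq (\<lambda>j. X j \<omega>) (2 ^ k) k" for k \<omega>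
  define Z where "Z k \<omega> = (1 / 4 ^ k) * (T k \<omega> + (real k + 1) * D k \<omega>)" for k \<omega>
  define u where "u k = (\<Sum>j\<in>{1..<2 ^ k}. b j) / 4 ^ k" for k :: nat
  define v where "v k = (real k + 1)\<^sup>2 * (\<Sum>j\<in>{2 ^ k..<2 ^ Suc k}. b j) / 4 ^ k" for k :: nat
  have pow: "1 \<le> j" if "2 ^ k \<le> j" for j k :: nat
    using that one_le_power[of "2::nat" k] by linarith
  have b: "0 \<le> b j" if "1 \<le> j" for j
    unfolding b_def by (intro expectation_nonneg square_mem X that) simp
  have mem: "T k \<in> H" "D k \<in> H" for k
    unfolding T_def D_def by (auto intro!: square_mem sum_mem dyadic_sq_mem X dest: pow)
  show Z: "Z k \<in> H" for k
    unfolding Z_def by (intro scale_mem add_mem mem)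
  show "0 \<le> Z k \<omega>" for k \<omega>
    unfolding Z_def T_def D_def by (simp add: dyadic_sq_nonneg)
  \<comment> \<open>The square in \<open>v k\<close> arises here: one factor
    \<open>real k + 1\<close> is the constant of the pointwise maximal inequality, the other counts
    the levels of the tree.\<close>
  have EZ: "EE (Z k) \<le> u k + v k" for k
  proof -
    have "EE (Z k) = (1 / 4 ^ k) * EE (\<lambda>\<omega>. T k \<omega> + (real k + 1) * D k \<omega>)"
      unfolding Z_def by (intro pos_homogeneous add_mem scale_mem mem) simp
    also have "\<dots> \<le> (1 / 4 ^ k) * ((\<Sum>j\<in>{1..<2 ^ k}. b j)
        + (real k + 1) * ((real k + 1) * (\<Sum>j\<in>{2 ^ k..<2 ^ Suc k}. b j)))"
    proof (rule mult_left_mono)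
      have "EE (\<lambda>\<omega>. T k \<omega> + (real k + 1) * D k \<omega>) \<le> EE (T k) + EE (\<lambda>\<omega>. (real k + 1) * D k \<omega>)"
        by (intro subadd scale_mem mem)
      also have "\<dots> = EE (T k) + (real k + 1) * EE (D k)"
        by (subst pos_homogeneous) (auto intro: mem)
      also have "\<dots> \<le> (\<Sum>j\<in>{1..<2 ^ k}. b j)
          + (real k + 1) * ((real k + 1) * (\<Sum>j\<in>{2 ^ k..<2 ^ k + 2 ^ k}. b j))"
      proof (intro add_mono mult_left_mono)
        show "EE (T k) \<le> (\<Sum>j\<in>{1..<2 ^ k}. b j)"
          unfolding T_def b_def by (intro expectation_square_sum_le X orth) auto
        show "EE (D k) \<le> (real k + 1) * (\<Sum>j\<in>{2 ^ k..<2 ^ k + 2 ^ k}. b j)"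
          unfolding D_def b_def by (intro expectation_dyadic_sq_le X orth) (auto dest: pow)
      qed simp
      finally show "EE (\<lambda>\<omega>. T k \<omega> + (real k + 1) * D k \<omega>) \<le> (\<Sum>j\<in>{1..<2 ^ k}. b j)
          + (real k + 1) * ((real k + 1) * (\<Sum>j\<in>{2 ^ k..<2 ^ Suc k}. b j))"
        by (simp add: mult_2)
    qed simp
    also have "\<dots> = u k + v k"
      unfolding u_def v_def by (simp add: add_divide_distrib power2_eq_square mult.assoc)
    finally show ?thesis .
  qed
  have v: "summable v"
    unfolding v_def using b sum by (intro summable_log_weighted_blocks) (auto simp: b_def)
  \<comment> \<open>Passing to the next block divides the old second moments by 4 and adds those of
    block \<open>k\<close>, which are at most \<open>v k\<close> because
    \<open>1 / 4 \<le> (real k + 1)\<^sup>2\<close>.\<close>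
  moreover have "summable u"
  proof (rule summable_quarter_recursion[OF _ _ _ v])
    show "0 \<le> u k" "0 \<le> v k" for k
      unfolding u_def v_def by (auto intro!: divide_nonneg_pos mult_nonneg_nonneg sum_nonneg b dest: pow)
    show "u (Suc k) \<le> u k / 4 + v k" for k
    proof -
      let ?B = "\<Sum>j\<in>{2 ^ k..<2 ^ Suc k}. b j"
      have B: "0 \<le> ?B" by (auto intro!: sum_nonneg b dest: pow)
      have "(\<Sum>j\<in>{1..<2 ^ Suc k}. b j) = (\<Sum>j\<in>{1..<2 ^ k}. b j) + ?B"
        by (rule sum.atLeastLessThan_concat[symmetric]) auto
      then have "u (Suc k) = u k / 4 + (1 / 4) * ?B / 4 ^ k"
        by (simp add: u_def add_divide_distrib)
      also have "(1 / 4) * ?B / 4 ^ k \<le> v k"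
        unfolding v_def using B one_le_power[of "real k + 1" 2] order_trans[of "1 / 4" 1 "(real k + 1)\<^sup>2"]
        by (intro divide_right_mono mult_right_mono) simp_all
      finally show ?thesis by simp
    qed
  qed
  ultimately have "summable (\<lambda>k. u k + v k)" by (simp add: summable_add)
  moreover have "norm (EE (Z k)) \<le> u k + v k" for k
    using EZ[of k] expectation_nonneg[OF Z[of k]] by (simp add: Z_def T_def D_def dyadic_sq_nonneg)
  ultimately show "summable (\<lambda>k. EE (Z k))" by (rule summable_comparison_test')
  show "((\<Sum>j=1..n. X j \<omega>) / real n)\<^sup>2 \<le> 2 * Z k \<omega>" if n: "2 ^ k \<le> n" "n < 2 ^ Suc k" for k n \<omega>
  proof -
    define A where "A = (\<Sum>j\<in>{1..<2 ^ k}. X j \<omega>)"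
    \<comment> \<open>The closed range from \<open>2 ^ k\<close> to \<open>n\<close> in half-open
      form. Its length \<open>n + 1 - 2 ^ k\<close> is at most \<open>2 ^ k\<close> since
      \<open>n < 2 ^ Suc k\<close>, as the maximal inequality requires.\<close>
    define B where "B = (\<Sum>j\<in>{2 ^ k..<2 ^ k + (n + 1 - 2 ^ k)}. X j \<omega>)"
    have "{1..n} = {1..<2 ^ k + (n + 1 - 2 ^ k)}" using n by auto
    then have AB: "(\<Sum>j=1..n. X j \<omega>) = A + B"
      unfolding A_def B_def by (subst sum.atLeastLessThan_concat) auto
    have B: "B\<^sup>2 \<le> (real k + 1) * D k \<omega>"
      unfolding B_def D_def using n by (intro Rademacher_Menshov_pointwise) simp
    have "2 ^ k \<le> real n" using n(1) by (metis of_nat_le_iff of_nat_numeral of_nat_power)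
    then have "(2 ^ k)\<^sup>2 \<le> (real n)\<^sup>2" by (intro power_mono) auto
    then have n4: "4 ^ k \<le> (real n)\<^sup>2" by (simp add: power2_eq_square flip: power_mult_distrib)
    have "((\<Sum>j=1..n. X j \<omega>) / real n)\<^sup>2 = (A + B)\<^sup>2 / (real n)\<^sup>2"
      unfolding AB by (rule power_divide)
    also have "\<dots> \<le> (A + B)\<^sup>2 / 4 ^ k"
      using n4 pow[OF n(1)] by (intro divide_left_mono) auto
    also have "\<dots> \<le> 2 * (A\<^sup>2 + (real k + 1) * D k \<omega>) / 4 ^ k"
      using sum_sq_le_weighted[of 1 A B] B by (intro divide_right_mono) auto
    finally show ?thesis by (simp add: Z_def T_def A_def)
  qed
qed

end

section \<open>The strong law for orthogonal sequences\<close>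

theorem theorem4p3:
  fixes M :: "'a measure"
    and H :: "('a \<Rightarrow> real) set"
    and EE :: "('a \<Rightarrow> real) \<Rightarrow> real"
    and X :: "nat \<Rightarrow> 'a \<Rightarrow> real"
  assumes "sublinear_expectation_space M H EE"
    and "outer_capacity M H EE (space M) = 1"
    and "\<And>n. 1 \<le> n \<Longrightarrow> X n \<in> H"
    and "\<And>i j. 1 \<le> i \<Longrightarrow> 1 \<le> j \<Longrightarrow> i \<noteq> j \<Longrightarrow> EE (\<lambda>\<omega>. X i \<omega> * X j \<omega>) = 0"
    and "\<And>n. 1 \<le> n \<Longrightarrow> EE (X n) = 0"
    and "(\<lambda>k. EE (\<lambda>\<omega>. (X k \<omega>)\<^sup>2) / (real k)\<^sup>2 * (log 2 (real k))\<^sup>2) summable_on {1..}"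
  shows "outer_capacity M H EE
           {\<omega> \<in> space M. (\<lambda>n. (\<Sum>k=1..n. X k \<omega>) / real n) \<longlonglongrightarrow> 0} = 1"
proof -
  interpret sublinear_expectation_space M H EE by fact
  let ?c = "\<lambda>k. EE (\<lambda>\<omega>. (X k \<omega>)\<^sup>2) / (real k)\<^sup>2 * (log 2 (real k))\<^sup>2"
  \<comment> \<open>The added index 0 contributes 0, since division by
    \<open>(real 0)\<^sup>2\<close> yields 0. All terms being nonnegative, unconditional and
    ordinary summability then agree.\<close>
  have "?c summable_on UNIV"
    using assms(6) by (rule summable_on_cong_neutral[THEN iffD1, rotated -1]) auto
  moreover have "0 \<le> EE (\<lambda>\<omega>. (X k \<omega>)\<^sup>2)" if "1 \<le> k" for k
    by (intro expectation_nonneg square_mem assms(3) that) simp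
  then have "0 \<le> ?c k" for k by (cases "k = 0") auto
  ultimately have sum: "summable ?c" by (simp add: summable_on_UNIV_nonneg_real_iff)
  obtain Z where Z: "\<And>k. Z k \<in> H" "\<And>k \<omega>. 0 \<le> Z k \<omega>" "summable (\<lambda>k. EE (Z k))"
    and dom: "\<And>k n \<omega>. 2 ^ k \<le> n \<Longrightarrow> n < 2 ^ Suc k \<Longrightarrow> ((\<Sum>j=1..n. X j \<omega>) / real n)\<^sup>2 \<le> 2 * Z k \<omega>"
    using dyadic_dominating_sequence[of X, OF assms(3,4) sum] by blast
  let ?G = "{\<omega> \<in> space M. (\<lambda>n. (\<Sum>k=1..n. X k \<omega>) / real n) \<longlonglongrightarrow> 0}"
  let ?N = "{\<omega> \<in> space M. \<not> (\<lambda>k. Z k \<omega>) \<longlonglongrightarrow> 0}"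
  have "(\<lambda>n. (\<Sum>k=1..n. X k \<omega>) / real n) \<longlonglongrightarrow> 0" if "(\<lambda>k. Z k \<omega>) \<longlonglongrightarrow> 0" for \<omega>
  proof (rule tendsto_zero_if_dyadic_bound)
    show "(\<lambda>k. 2 * Z k \<omega>) \<longlonglongrightarrow> 0" using tendsto_mult_left[OF that, of 2] by simp
  qed (rule dom)
  then have "space M \<subseteq> ?G \<union> ?N" by auto
  \<comment> \<open>The normalisation of \<open>outer\<close> on \<open>space M\<close> gives both
    bounds: the lower one through this cover with the null event \<open>?N\<close>, the upper one by
    monotonicity.\<close>
  then have "1 \<le> outer (?G \<union> ?N)" using outer_capacity_mono[of "space M" "?G \<union> ?N"] assms(2) by simp
  also have "\<dots> \<le> outer ?G + outer ?N" by (rule outer_capacity_subadditive)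
  also have "outer ?N = 0" using Z by (intro outer_capacity_not_tendsto_zero)
  finally have "1 \<le> outer ?G" by simp
  moreover have "outer ?G \<le> 1" using outer_capacity_mono[of ?G "space M"] assms(2) by auto
  ultimately show ?thesis by simp
qed

end
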